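(* Suppose that $\Sigma$ is a row-finite $k$-graph with no sources, and $\alpha$ is a free action of an Ore semigroup $S$ on $\Sigma$ which admits a fundamental domain $F$. Let $q:\Sigma\to S\backslash \Sigma$ be the quotient map, and define $c:S\backslash \Sigma\to F$, $\eta:S\backslash \Sigma\to S$ and $\xi:\Sigma\to S$ by \[ q(c(\lambda))=\lambda,\qquad s(c(\lambda))=\alpha_{\eta(\lambda)}(c(s(\lambda)))\qquad\text{and}\qquad \sigma=\alpha_{\xi(\sigma)}(c(q(\sigma))) \] for $\lambda\in S\backslash\Sigma$ and $\sigma\in\Sigma$. Then $\eta:S\backslash \Sigma\to S$ is a functor, and the map $\phi(\sigma):=(q(\sigma),\xi(\sigma))$ is an isomorphism of $\Sigma$ onto the skew product $(S\backslash \Sigma)\times_\eta S$, with inverse given by $\phi^{-1}(\lambda,t)=\alpha_t(c(\lambda))$. The isomorphism $\phi$ satisfies $\phi\circ\alpha_t=\operatorname{lt}_t\circ\phi$ for all $t\in S$.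
   Context: Let $k\ge 1$ and $\mathbb{N}=\{0,1,2,\dots\}$. A $k$-graph is a countable category $\Lambda$ with codomain (range) map $r$ and domain (source) map $s$, together with a functor $d:\Lambda\to\mathbb{N}^k$ (degree) satisfying the factorisation property: for every $\lambda\in\Lambda$ and decomposition $d(\lambda)=m+n$ with $m,n\in\mathbb{N}^k$ there is a unique pair $(\mu,\nu)$ with $s(\mu)=r(\nu)$, $d(\mu)=m$, $d(\nu)=n$, $\lambda=\mu\nu$. Write $\Lambda^n:=d^{-1}(n)$; the objects are identified with $\Lambda^0$, and $v\Lambda^n:=r^{-1}(v)\cap\Lambda^n$. $\Lambda$ is row-finite with no sources if $v\Lambda^n$ is finite and nonempty for all $v\in\Lambda^0$, $n\in\mathbb{N}^k$. A $k$-graph morphism is a degree-preserving functor; an isomorphism is a bijective $k$-graph morphism. All semigroups are countable with identity $1$. An Ore semigroup is a cancellative semigroup $S$ such that for all $t,u\in S$ there exist $x,y\in S$ with $xt=yu$. An action $\alpha$ of $S$ on $\Sigma$ assigns to each $t\in S$ a $k$-graph morphism $\alpha_t:\Sigma\to\Sigma$ with $\alpha_1=\mathrm{id}$ and $\alpha_{tu}=\alpha_t\circ\alpha_u$; it is free if $\alpha_t(\lambda)=\alpha_u(\lambda)$ for some $\lambda$ implies $t=u$. A fundamental domain is a subset $F\subset\Sigma$ such that for every $\sigma\in\Sigma$ there are exactly one $\mu\in F$ and one $t\in S$ with $\alpha_t(\mu)=\sigma$, and such that $r(\mu)\in F$ for every $\mu\in F$. For a free action, $\lambda\sim\mu$ iff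 $\alpha_t(\lambda)=\alpha_u(\mu)$ for some $t,u\in S$; this is an equivalence relation. $S\backslash\Sigma$ is the set of classes, with $d([\lambda])=d(\lambda)$, $r([\lambda])=[r(\lambda)]$, $s([\lambda])=[s(\lambda)]$ and, when $[s(\lambda)]=[r(\mu)]$, composition $[\lambda][\mu]=[\alpha_t(\lambda)\alpha_u(\mu)]$ where $t,u\in S$ satisfy $\alpha_t(s(\lambda))=\alpha_u(r(\mu))$. This is a $k$-graph, and $q(\lambda)=[\lambda]$. If $\Lambda$ is a $k$-graph and $\eta:\Lambda\to S$ is a functor into a semigroup $S$ (viewed as a category with one object), the skew product $\Lambda\times_\eta S$ is the $k$-graph with underlying set $\Lambda\times S$, vertex set $\Lambda^0\times S$, $r(\lambda,t)=(r(\lambda),t)$, $s(\lambda,t)=(s(\lambda),t\eta(\lambda))$, composition $(\lambda,t)(\mu,u)=(\lambda\mu,t)$ when $s(\lambda)=r(\mu)$ and $u=t\eta(\lambda)$, and $d(\lambda,t)=d(\lambda)$. It carries the action $\operatorname{lt}$ of $S$ given by $\operatorname{lt}_u(\lambda,t)=(\lambda,ut)$. *)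

theory Defs
  imports "HOL-Algebra.Divisibility" "HOL-Analysis.Finite_Cartesian_Product"
    "HOL-Library.Countable_Set" "HOL-Library.FuncSet"
begin

text \<open>
  Small categories are presented by their morphisms alone: an object is identified with its
  identity morphism, so range and source take values in the morphisms. Composition is written
  in the order of \<open>k\<close>-graph theory: \<open>f \<star> g\<close> is meaningful when \<open>src f = rng g\<close>.
\<close>

record 'a cat =
  arr :: "'a set"
  rng :: "'a \<Rightarrow> 'a"
  src :: "'a \<Rightarrow> 'a"
  cat_comp :: "'a \<Rightarrow> 'a \<Rightarrow> 'a" (infixl \<open>\<star>\<index>\<close> 70)

locale category =
  fixes C :: "('a, 'x) cat_scheme" (structure)
  assumes rng_arr: "f \<in> arr C \<Longrightarrow> rng C f \<in> arr C"
    and src_arr: "f \<in> arr C \<Longrightarrow> src C f \<in> arr C"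
    and rng_rng: "f \<in> arr C \<Longrightarrow> rng C (rng C f) = rng C f"
    and src_rng: "f \<in> arr C \<Longrightarrow> src C (rng C f) = rng C f"
    and rng_src: "f \<in> arr C \<Longrightarrow> rng C (src C f) = src C f"
    and src_src: "f \<in> arr C \<Longrightarrow> src C (src C f) = src C f"
    and comp_arr: "\<lbrakk>f \<in> arr C; g \<in> arr C; src C f = rng C g\<rbrakk> \<Longrightarrow> f \<star> g \<in> arr C"
    and rng_comp: "\<lbrakk>f \<in> arr C; g \<in> arr C; src C f = rng C g\<rbrakk> \<Longrightarrow> rng C (f \<star> g) = rng C f"
    and src_comp: "\<lbrakk>f \<in> arr C; g \<in> arr C; src C f = rng C g\<rbrakk> \<Longrightarrow> src C (f \<star> g) = src C g"
    and comp_assoc: "\<lbrakk>f \<in> arr C; g \<in> arr C; h \<in> arr C; src C f = rng C g; src C g = rng C h\<rbrakk>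
        \<Longrightarrow> (f \<star> g) \<star> h = f \<star> (g \<star> h)"
    and comp_rng: "f \<in> arr C \<Longrightarrow> rng C f \<star> f = f"
    and comp_src: "f \<in> arr C \<Longrightarrow> f \<star> src C f = f"

definition obj :: "('a, 'x) cat_scheme \<Rightarrow> 'a set" where
  "obj C = {v \<in> arr C. rng C v = v}"

text \<open>
  Since objects are identity morphisms, preservation of identities is contained in preservation
  of range and source.
\<close>

locale cat_functor = dom: category C + cod: category D
  for C :: "('a, 'x) cat_scheme" and D :: "('b, 'y) cat_scheme" +
  fixes f :: "'a \<Rightarrow> 'b"
  assumes map_arr: "a \<in> arr C \<Longrightarrow> f a \<in> arr D"
    and map_rng: "a \<in> arr C \<Longrightarrow> f (rng C a) = rng D (f a)"
    and map_src: "a \<in> arr C \<Longrightarrow> f (src C a) = src D (f a)"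
    and map_comp: "\<lbrakk>a \<in> arr C; b \<in> arr C; src C a = rng C b\<rbrakk>
        \<Longrightarrow> f (a \<star>\<^bsub>C\<^esub> b) = f a \<star>\<^bsub>D\<^esub> f b"

text \<open>A monoid as a category with one object, namely the identity element.\<close>

definition monoid_cat :: "('s, 'm) monoid_scheme \<Rightarrow> 's cat" where
  "monoid_cat S = \<lparr>arr = carrier S, rng = (\<lambda>_. \<one>\<^bsub>S\<^esub>), src = (\<lambda>_. \<one>\<^bsub>S\<^esub>), cat_comp = mult S\<rparr>"

text \<open>
  \<open>\<nat>\<^sup>k\<close> is \<^typ>\<open>nat ^ 'k\<close> with \<open>k = CARD('k) \<ge> 1\<close>; as a monoid it is additive.
\<close>

definition degree_monoid :: "(nat ^ 'k::finite) monoid" where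
  "degree_monoid = \<lparr>carrier = UNIV, mult = (+), one = 0\<rparr>"

record ('a, 'k) kgraph = "'a cat" +
  deg :: "'a \<Rightarrow> nat ^ 'k"

definition level :: "('a, 'k::finite, 'x) kgraph_scheme \<Rightarrow> nat ^ 'k \<Rightarrow> 'a set" where
  "level \<Lambda> n = {l \<in> arr \<Lambda>. deg \<Lambda> l = n}"

definition level_at :: "('a, 'k::finite, 'x) kgraph_scheme \<Rightarrow> 'a \<Rightarrow> nat ^ 'k \<Rightarrow> 'a set" where
  "level_at \<Lambda> v n = {l \<in> level \<Lambda> n. rng \<Lambda> l = v}"

locale k_graph = category \<Lambda>
  for \<Lambda> :: "('a, 'k::finite, 'x) kgraph_scheme" (structure) +
  assumes countable_arr: "countable (arr \<Lambda>)"
    and deg_functor: "cat_functor \<Lambda> (monoid_cat degree_monoid) (deg \<Lambda>)"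
    and factorisation: "\<lbrakk>l \<in> arr \<Lambda>; deg \<Lambda> l = m + n\<rbrakk> \<Longrightarrow>
        \<exists>!(\<mu>, \<nu>). \<mu> \<in> arr \<Lambda> \<and> \<nu> \<in> arr \<Lambda> \<and> src \<Lambda> \<mu> = rng \<Lambda> \<nu> \<and>
          deg \<Lambda> \<mu> = m \<and> deg \<Lambda> \<nu> = n \<and> l = \<mu> \<star> \<nu>"

text \<open>The usual identification of the objects with \<open>\<Lambda>\<^sup>0\<close>.\<close>

lemma (in k_graph) level_zero: "level \<Lambda> 0 = obj \<Lambda>"
proof -
  interpret d: cat_functor \<Lambda> "monoid_cat degree_monoid" "deg \<Lambda>" by (rule deg_functor)
  have dr: "deg \<Lambda> (rng \<Lambda> l) = 0" and ds: "deg \<Lambda> (src \<Lambda> l) = 0" if "l \<in> arr \<Lambda>" for l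
    using d.map_rng[OF that] d.map_src[OF that] by (simp_all add: monoid_cat_def degree_monoid_def)
  have "rng \<Lambda> l = l" if l: "l \<in> arr \<Lambda>" "deg \<Lambda> l = 0" for l
  proof -
    let ?P = "\<lambda>p. fst p \<in> arr \<Lambda> \<and> snd p \<in> arr \<Lambda> \<and> src \<Lambda> (fst p) = rng \<Lambda> (snd p) \<and>
      deg \<Lambda> (fst p) = 0 \<and> deg \<Lambda> (snd p) = 0 \<and> l = fst p \<star> snd p"
    have "deg \<Lambda> l = 0 + 0" using l by simp
    from factorisation[OF l(1) this] have ex: "\<exists>!p. ?P p"
      by (simp only: case_prod_unfold)
    have 1: "?P (rng \<Lambda> l, l)"
      using l dr rng_arr src_rng comp_rng by simp
    have 2: "?P (l, src \<Lambda> l)"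
      using l ds src_arr rng_src comp_src by simp
    have "(rng \<Lambda> l, l) = (l, src \<Lambda> l)"
      using the1_equality[OF ex 1] the1_equality[OF ex 2] by (rule trans[OF sym])
    then show ?thesis by simp
  qed
  moreover have "deg \<Lambda> l = 0" if "l \<in> arr \<Lambda>" "rng \<Lambda> l = l" for l
    using dr[OF that(1)] that(2) by simp
  ultimately show ?thesis by (auto simp: level_def obj_def)
qed

definition row_finite_no_sources :: "('a, 'k::finite, 'x) kgraph_scheme \<Rightarrow> bool" where
  "row_finite_no_sources \<Lambda> \<longleftrightarrow>
     (\<forall>v \<in> level \<Lambda> 0. \<forall>n. finite (level_at \<Lambda> v n) \<and> level_at \<Lambda> v n \<noteq> {})"

locale kgraph_morphism = dom: k_graph \<Lambda> + cod: k_graph \<Gamma> + cat_functor \<Lambda> \<Gamma> f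
  for \<Lambda> :: "('a, 'k::finite, 'x) kgraph_scheme" and \<Gamma> :: "('b, 'k, 'y) kgraph_scheme"
    and f :: "'a \<Rightarrow> 'b" +
  assumes deg_map: "a \<in> arr \<Lambda> \<Longrightarrow> deg \<Gamma> (f a) = deg \<Lambda> a"

locale kgraph_iso = kgraph_morphism \<Lambda> \<Gamma> f
  for \<Lambda> :: "('a, 'k::finite, 'x) kgraph_scheme" and \<Gamma> :: "('b, 'k, 'y) kgraph_scheme"
    and f :: "'a \<Rightarrow> 'b" +
  assumes bij: "bij_betw f (arr \<Lambda>) (arr \<Gamma>)"

locale ore_semigroup = monoid_cancel S for S :: "('s, 'm) monoid_scheme" (structure) +
  assumes countable_carrier: "countable (carrier S)"
    and ore: "\<lbrakk>t \<in> carrier S; u \<in> carrier S\<rbrakk>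
        \<Longrightarrow> \<exists>x \<in> carrier S. \<exists>y \<in> carrier S. x \<otimes> t = y \<otimes> u"

definition kgraph_action ::
    "('s, 'm) monoid_scheme \<Rightarrow> ('a, 'k::finite, 'x) kgraph_scheme \<Rightarrow> ('s \<Rightarrow> 'a \<Rightarrow> 'a) \<Rightarrow> bool" where
  "kgraph_action S \<Sigma> \<alpha> \<longleftrightarrow>
     (\<forall>t \<in> carrier S. kgraph_morphism \<Sigma> \<Sigma> (\<alpha> t)) \<and>
     (\<forall>l \<in> arr \<Sigma>. \<alpha> \<one>\<^bsub>S\<^esub> l = l) \<and>
     (\<forall>t \<in> carrier S. \<forall>u \<in> carrier S. \<forall>l \<in> arr \<Sigma>. \<alpha> (t \<otimes>\<^bsub>S\<^esub> u) l = \<alpha> t (\<alpha> u l))"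

definition free_kgraph_action ::
    "('s, 'm) monoid_scheme \<Rightarrow> ('a, 'k::finite, 'x) kgraph_scheme \<Rightarrow> ('s \<Rightarrow> 'a \<Rightarrow> 'a) \<Rightarrow> bool" where
  "free_kgraph_action S \<Sigma> \<alpha> \<longleftrightarrow> kgraph_action S \<Sigma> \<alpha> \<and>
     (\<forall>t \<in> carrier S. \<forall>u \<in> carrier S. (\<exists>l \<in> arr \<Sigma>. \<alpha> t l = \<alpha> u l) \<longrightarrow> t = u)"

definition fundamental_domain ::
    "('s, 'm) monoid_scheme \<Rightarrow> ('a, 'k::finite, 'x) kgraph_scheme \<Rightarrow> ('s \<Rightarrow> 'a \<Rightarrow> 'a) \<Rightarrow> 'a set \<Rightarrow> bool"
  where
  "fundamental_domain S \<Sigma> \<alpha> F \<longleftrightarrow> F \<subseteq> arr \<Sigma> \<and>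
     (\<forall>\<sigma> \<in> arr \<Sigma>. \<exists>!(\<mu>, t). \<mu> \<in> F \<and> t \<in> carrier S \<and> \<alpha> t \<mu> = \<sigma>) \<and>
     (\<forall>\<mu> \<in> F. rng \<Sigma> \<mu> \<in> F)"

definition orbit_rel ::
    "('s, 'm) monoid_scheme \<Rightarrow> ('a, 'k::finite, 'x) kgraph_scheme \<Rightarrow> ('s \<Rightarrow> 'a \<Rightarrow> 'a) \<Rightarrow> 'a rel" where
  "orbit_rel S \<Sigma> \<alpha> = {(l, m). l \<in> arr \<Sigma> \<and> m \<in> arr \<Sigma> \<and>
     (\<exists>t \<in> carrier S. \<exists>u \<in> carrier S. \<alpha> t l = \<alpha> u m)}"

definition orbit_map ::
    "('s, 'm) monoid_scheme \<Rightarrow> ('a, 'k::finite, 'x) kgraph_scheme \<Rightarrow> ('s \<Rightarrow> 'a \<Rightarrow> 'a) \<Rightarrow> 'a \<Rightarrow> 'a set"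
  where
  "orbit_map S \<Sigma> \<alpha> l = orbit_rel S \<Sigma> \<alpha> `` {l}"

text \<open>
  The operations on classes are given by definite description over all representatives (and, for
  the composition, over all admissible translates), so nothing is built in about their being
  well defined.
\<close>

definition quotient_kgraph ::
    "('s, 'm) monoid_scheme \<Rightarrow> ('a, 'k::finite, 'x) kgraph_scheme \<Rightarrow> ('s \<Rightarrow> 'a \<Rightarrow> 'a)
      \<Rightarrow> ('a set, 'k) kgraph" where
  "quotient_kgraph S \<Sigma> \<alpha> =
     \<lparr>arr = arr \<Sigma> // orbit_rel S \<Sigma> \<alpha>,
      rng = (\<lambda>A. THE C. \<exists>l \<in> A. C = orbit_map S \<Sigma> \<alpha> (rng \<Sigma> l)),
      src = (\<lambda>A. THE C. \<exists>l \<in> A. C = orbit_map S \<Sigma> \<alpha> (src \<Sigma> l)),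
      cat_comp = (\<lambda>A B. THE C. \<exists>l \<in> A. \<exists>m \<in> B. \<exists>t \<in> carrier S. \<exists>u \<in> carrier S.
         \<alpha> t (src \<Sigma> l) = \<alpha> u (rng \<Sigma> m) \<and> C = orbit_map S \<Sigma> \<alpha> (\<alpha> t l \<star>\<^bsub>\<Sigma>\<^esub> \<alpha> u m)),
      deg = (\<lambda>A. THE n. \<exists>l \<in> A. n = deg \<Sigma> l)\<rparr>"

text \<open>The skew product; \<open>\<eta>\<close> is meant to be a functor from \<open>\<Lambda>\<close> to \<^term>\<open>monoid_cat S\<close>.\<close>

definition skew_product ::
    "('a, 'k::finite, 'x) kgraph_scheme \<Rightarrow> ('a \<Rightarrow> 's) \<Rightarrow> ('s, 'm) monoid_scheme \<Rightarrow> ('a \<times> 's, 'k) kgraph"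
  where
  "skew_product \<Lambda> \<eta> S =
     \<lparr>arr = arr \<Lambda> \<times> carrier S,
      rng = (\<lambda>(l, t). (rng \<Lambda> l, t)),
      src = (\<lambda>(l, t). (src \<Lambda> l, t \<otimes>\<^bsub>S\<^esub> \<eta> l)),
      cat_comp = (\<lambda>(l, t) (m, u). (l \<star>\<^bsub>\<Lambda>\<^esub> m, t)),
      deg = (\<lambda>(l, t). deg \<Lambda> l)\<rparr>"

definition left_translation :: "('s, 'm) monoid_scheme \<Rightarrow> 's \<Rightarrow> 'a \<times> 's \<Rightarrow> 'a \<times> 's" where
  "left_translation S u = (\<lambda>(l, t). (l, u \<otimes>\<^bsub>S\<^esub> t))"

text \<open>
  The equations defining \<open>c\<close>, \<open>\<eta>\<close> and \<open>\<xi>\<close>. The maps are taken extensional, so that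
  they can be said to be uniquely determined by these equations.
\<close>

definition domain_maps ::
    "('s, 'm) monoid_scheme \<Rightarrow> ('a, 'k::finite, 'x) kgraph_scheme \<Rightarrow> ('s \<Rightarrow> 'a \<Rightarrow> 'a) \<Rightarrow> 'a set
      \<Rightarrow> ('a set \<Rightarrow> 'a) \<Rightarrow> ('a set \<Rightarrow> 's) \<Rightarrow> ('a \<Rightarrow> 's) \<Rightarrow> bool" where
  "domain_maps S \<Sigma> \<alpha> F c \<eta> \<xi> \<longleftrightarrow>
     (let Q = quotient_kgraph S \<Sigma> \<alpha>; q = orbit_map S \<Sigma> \<alpha> in
        c \<in> arr Q \<rightarrow>\<^sub>E F \<and> \<eta> \<in> arr Q \<rightarrow>\<^sub>E carrier S \<and> \<xi> \<in> arr \<Sigma> \<rightarrow>\<^sub>E carrier S \<and>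
        (\<forall>l \<in> arr Q. q (c l) = l) \<and>
        (\<forall>l \<in> arr Q. src \<Sigma> (c l) = \<alpha> (\<eta> l) (c (src Q l))) \<and>
        (\<forall>\<sigma> \<in> arr \<Sigma>. \<sigma> = \<alpha> (\<xi> \<sigma>) (c (q \<sigma>))))"

end

theory Submission
  imports Defs
begin

text \<open>
  Every \<open>\<sigma>\<close> factors uniquely as \<open>\<alpha>\<^sub>t(\<mu>)\<close> with \<open>\<mu> \<in> F\<close>; the Ore condition makes \<open>\<sigma> \<sim> \<tau>\<close> equivalent
  to having the same factor in \<open>F\<close>. Since \<open>F\<close> is closed under ranges, the translating element of
  \<open>\<sigma>\<close> is that of \<open>r(\<sigma>)\<close>. Hence, for fixed \<open>\<sigma>\<close>, each class whose range is \<open>[s(\<sigma>)]\<close> has a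
  representative with range \<open>s(\<sigma>)\<close>, and the category axioms of the quotient lift to \<open>\<Sigma>\<close>. The cocycle
  identity for \<open>\<eta>\<close> follows by cancellation from \<open>\<xi>(s(\<sigma>)) = \<xi>(\<sigma>) \<eta>(q(\<sigma>))\<close>, and the skew product is
  a \<open>k\<close>-graph because its structure is that of \<open>\<Sigma>\<close> transported along the bijection \<open>\<phi>\<close>.
\<close>

section \<open>Degrees, and transport of \<open>k\<close>-graph structure along a bijection\<close>

lemma (in k_graph) deg_simps:
  assumes "l \<in> arr \<Lambda>"
  shows "deg \<Lambda> (rng \<Lambda> l) = 0" "deg \<Lambda> (src \<Lambda> l) = 0"
    "\<lbrakk>m \<in> arr \<Lambda>; src \<Lambda> l = rng \<Lambda> m\<rbrakk> \<Longrightarrow> deg \<Lambda> (l \<star> m) = deg \<Lambda> l + deg \<Lambda> m"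
proof -
  interpret d: cat_functor \<Lambda> "monoid_cat degree_monoid" "deg \<Lambda>" by (rule deg_functor)
  show "deg \<Lambda> (rng \<Lambda> l) = 0" "deg \<Lambda> (src \<Lambda> l) = 0"
    "\<lbrakk>m \<in> arr \<Lambda>; src \<Lambda> l = rng \<Lambda> m\<rbrakk> \<Longrightarrow> deg \<Lambda> (l \<star> m) = deg \<Lambda> l + deg \<Lambda> m"
    using d.map_rng[OF assms] d.map_src[OF assms] d.map_comp[OF assms]
    by (simp_all add: monoid_cat_def degree_monoid_def)
qed

lemma monoid_cat_category: "monoid S \<Longrightarrow> category (monoid_cat S)"
  unfolding category_def monoid_cat_def
  by (simp add: monoid.m_closed monoid.m_assoc monoid.l_one monoid.r_one monoid.one_closed)

text \<open>All arrows of the bare record \<open>D\<close> are values of \<open>f\<close>, so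
  injectivity and the four compatibility hypotheses turn each axiom for \<open>D\<close> into the
  same axiom for \<open>\<Lambda>\<close>. Applied to the skew product, this yields its
  \<open>k\<close>-graph axioms and the isomorphism together.\<close>

lemma (in k_graph) transport_iso:
  fixes D :: "('b, 'k, 'y) kgraph_scheme"
  assumes bij: "bij_betw f (arr \<Lambda>) (arr D)"
    and rng: "\<And>a. a \<in> arr \<Lambda> \<Longrightarrow> rng D (f a) = f (rng \<Lambda> a)"
    and src: "\<And>a. a \<in> arr \<Lambda> \<Longrightarrow> src D (f a) = f (src \<Lambda> a)"
    and cmp: "\<And>a b. \<lbrakk>a \<in> arr \<Lambda>; b \<in> arr \<Lambda>; src \<Lambda> a = rng \<Lambda> b\<rbrakk>
      \<Longrightarrow> f a \<star>\<^bsub>D\<^esub> f b = f (a \<star> b)"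
    and dg: "\<And>a. a \<in> arr \<Lambda> \<Longrightarrow> deg D (f a) = deg \<Lambda> a"
  shows "kgraph_iso \<Lambda> D f"
proof -
  have arrD: "arr D = f ` arr \<Lambda>" and inj: "inj_on f (arr \<Lambda>)"
    using bij by (auto simp: bij_betw_def)
  have eqD: "f a = f b \<longleftrightarrow> a = b" if "a \<in> arr \<Lambda>" "b \<in> arr \<Lambda>" for a b
    using inj that by (auto dest: inj_onD)
  note simps = rng src cmp dg eqD rng_arr src_arr rng_rng src_rng rng_src src_src
    comp_arr rng_comp src_comp comp_rng comp_src deg_simps
  have catD: "category D"
    by unfold_locales (auto simp: arrD simps comp_assoc)
  have degD: "cat_functor D (monoid_cat degree_monoid) (deg D)"
  proof -
    have "monoid (degree_monoid :: (nat ^ 'k) monoid)"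
      by unfold_locales (auto simp: degree_monoid_def add.assoc)
    then show ?thesis
      unfolding cat_functor_def cat_functor_axioms_def
      using catD monoid_cat_category
      by (auto simp: arrD simps) (auto simp: monoid_cat_def degree_monoid_def)
  qed
  have kD: "k_graph D"
    unfolding k_graph_def k_graph_axioms_def
  proof (intro conjI allI impI)
    show "category D" by (rule catD)
    show "countable (arr D)" using countable_arr by (simp add: arrD)
    show "cat_functor D (monoid_cat degree_monoid) (deg D)" by (rule degD)
  next
    fix x m n assume x: "x \<in> arr D" "deg D x = m + n"
    then obtain l where l: "l \<in> arr \<Lambda>" "x = f l" by (auto simp: arrD)
    have dl: "deg \<Lambda> l = m + n" using x l dg by simp
    from factorisation[OF l(1) dl] obtain \<mu> \<nu> where
      fac: "\<mu> \<in> arr \<Lambda>" "\<nu> \<in> arr \<Lambda>" "src \<Lambda> \<mu> = rng \<Lambda> \<nu>" "deg \<Lambda> \<mu> = m" "deg \<Lambda> \<nu> = n" "l = \<mu> \<star> \<nu>"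
      and uniq: "\<And>\<mu>' \<nu>'. \<lbrakk>\<mu>' \<in> arr \<Lambda>; \<nu>' \<in> arr \<Lambda>; src \<Lambda> \<mu>' = rng \<Lambda> \<nu>'; deg \<Lambda> \<mu>' = m;
        deg \<Lambda> \<nu>' = n; l = \<mu>' \<star> \<nu>'\<rbrakk> \<Longrightarrow> \<mu>' = \<mu> \<and> \<nu>' = \<nu>"
      unfolding case_prod_unfold by (elim ex1E) (metis fst_conv snd_conv)
    show "\<exists>!(\<mu>, \<nu>). \<mu> \<in> arr D \<and> \<nu> \<in> arr D \<and> src D \<mu> = rng D \<nu> \<and>
          deg D \<mu> = m \<and> deg D \<nu> = n \<and> x = \<mu> \<star>\<^bsub>D\<^esub> \<nu>"
    proof (rule ex1I[of _ "(f \<mu>, f \<nu>)"])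
      show "case (f \<mu>, f \<nu>) of (\<mu>, \<nu>) \<Rightarrow> \<mu> \<in> arr D \<and> \<nu> \<in> arr D \<and> src D \<mu> = rng D \<nu> \<and>
          deg D \<mu> = m \<and> deg D \<nu> = n \<and> x = \<mu> \<star>\<^bsub>D\<^esub> \<nu>"
        using fac l by (simp add: arrD simps)
    next
      fix p assume "case p of (\<mu>, \<nu>) \<Rightarrow> \<mu> \<in> arr D \<and> \<nu> \<in> arr D \<and> src D \<mu> = rng D \<nu> \<and>
          deg D \<mu> = m \<and> deg D \<nu> = n \<and> x = \<mu> \<star>\<^bsub>D\<^esub> \<nu>"
      then obtain a b where p: "p = (f a, f b)" "a \<in> arr \<Lambda>" "b \<in> arr \<Lambda>"
        and 1: "src D (f a) = rng D (f b)" "deg D (f a) = m" "deg D (f b) = n"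
          "f l = f a \<star>\<^bsub>D\<^esub> f b"
        using l by (auto simp: arrD split: prod.splits)
      \<comment> \<open>Injectivity of \<open>f\<close> pulls a factorisation in \<open>D\<close>
        back to one in \<open>\<Lambda>\<close>, where \<open>uniq\<close> applies.\<close>
      have ab: "src \<Lambda> a = rng \<Lambda> b" using 1(1) p by (simp add: simps)
      moreover have "l = a \<star> b" using 1(4) p l ab by (simp add: simps)
      ultimately show "p = (f \<mu>, f \<nu>)" using uniq[of a b] p 1 by (simp add: dg)
    qed
  qed
  have "cat_functor \<Lambda> D f"
    using catD category_axioms
    by (auto simp: cat_functor_def cat_functor_axioms_def arrD simps)
  then show ?thesis
    using kD k_graph_axioms bij dg
    by (simp add: kgraph_iso_def kgraph_iso_axioms_def kgraph_morphism_def
        kgraph_morphism_axioms_def)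
qed

section \<open>Decomposition of arrows over the fundamental domain\<close>

locale domain_action = k_graph \<Sigma> + S: ore_semigroup S
  for \<Sigma> :: "('a, 'k::finite, 'x) kgraph_scheme" and S :: "('s, 'm) monoid_scheme" +
  fixes \<alpha> :: "'s \<Rightarrow> 'a \<Rightarrow> 'a" and F :: "'a set"
  assumes action: "kgraph_action S \<Sigma> \<alpha>"
    and fundom: "fundamental_domain S \<Sigma> \<alpha> F"
begin

abbreviation q :: "'a \<Rightarrow> 'a set" where "q \<equiv> orbit_map S \<Sigma> \<alpha>"
abbreviation Q :: "('a set, 'k) kgraph" where "Q \<equiv> quotient_kgraph S \<Sigma> \<alpha>"

text \<open>On arrows this is \<open>c(q(\<sigma>))\<close>, and \<open>trans_part\<close> is
  \<open>\<xi>(\<sigma>)\<close>. Both are read off the decomposition alone, so that the operations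
  of the quotient can be checked in terms of them.\<close>

definition dom_part :: "'a \<Rightarrow> 'a" where
  "dom_part \<sigma> = (THE \<mu>. \<mu> \<in> F \<and> (\<exists>t \<in> carrier S. \<alpha> t \<mu> = \<sigma>))"

definition trans_part :: "'a \<Rightarrow> 's" where
  "trans_part \<sigma> = (THE t. t \<in> carrier S \<and> \<alpha> t (dom_part \<sigma>) = \<sigma>)"

lemma F_arr: "\<mu> \<in> F \<Longrightarrow> \<mu> \<in> arr \<Sigma>"
  and F_rng: "\<mu> \<in> F \<Longrightarrow> rng \<Sigma> \<mu> \<in> F"
  using fundom by (auto simp: fundamental_domain_def)

lemma act_arr: "\<lbrakk>t \<in> carrier S; l \<in> arr \<Sigma>\<rbrakk> \<Longrightarrow> \<alpha> t l \<in> arr \<Sigma>"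
  and act_rng: "\<lbrakk>t \<in> carrier S; l \<in> arr \<Sigma>\<rbrakk> \<Longrightarrow> rng \<Sigma> (\<alpha> t l) = \<alpha> t (rng \<Sigma> l)"
  and act_src: "\<lbrakk>t \<in> carrier S; l \<in> arr \<Sigma>\<rbrakk> \<Longrightarrow> src \<Sigma> (\<alpha> t l) = \<alpha> t (src \<Sigma> l)"
  and act_comp: "\<lbrakk>t \<in> carrier S; l \<in> arr \<Sigma>; m \<in> arr \<Sigma>; src \<Sigma> l = rng \<Sigma> m\<rbrakk>
    \<Longrightarrow> \<alpha> t (l \<star>\<^bsub>\<Sigma>\<^esub> m) = \<alpha> t l \<star>\<^bsub>\<Sigma>\<^esub> \<alpha> t m"
  and act_deg: "\<lbrakk>t \<in> carrier S; l \<in> arr \<Sigma>\<rbrakk> \<Longrightarrow> deg \<Sigma> (\<alpha> t l) = deg \<Sigma> l"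
  and act_one: "l \<in> arr \<Sigma> \<Longrightarrow> \<alpha> \<one>\<^bsub>S\<^esub> l = l"
  and act_mult: "\<lbrakk>t \<in> carrier S; u \<in> carrier S; l \<in> arr \<Sigma>\<rbrakk> \<Longrightarrow> \<alpha> (t \<otimes>\<^bsub>S\<^esub> u) l = \<alpha> t (\<alpha> u l)"
  using action
  by (simp_all add: kgraph_action_def kgraph_morphism_def kgraph_morphism_axioms_def
      cat_functor_def cat_functor_axioms_def)

lemma decomp_unique:
  assumes "\<mu> \<in> F" "\<nu> \<in> F" "t \<in> carrier S" "u \<in> carrier S" "\<alpha> t \<mu> = \<alpha> u \<nu>"
  shows "\<mu> = \<nu> \<and> t = u"
proof -
  have "\<exists>!p. fst p \<in> F \<and> snd p \<in> carrier S \<and> \<alpha> (snd p) (fst p) = \<alpha> t \<mu>"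
    using fundom act_arr[OF assms(3) F_arr[OF assms(1)]]
    by (simp add: fundamental_domain_def case_prod_unfold)
  then have "(\<mu>, t) = (\<nu>, u)" by (rule ex1E) (metis assms fst_conv snd_conv)
  then show ?thesis by simp
qed

lemma decomp_act:
  assumes "\<mu> \<in> F" "t \<in> carrier S"
  shows "dom_part (\<alpha> t \<mu>) = \<mu>" "trans_part (\<alpha> t \<mu>) = t"
proof -
  show 1: "dom_part (\<alpha> t \<mu>) = \<mu>"
    unfolding dom_part_def using assms by (auto intro!: the_equality dest: decomp_unique)
  show "trans_part (\<alpha> t \<mu>) = t"
    unfolding trans_part_def 1 using assms by (auto intro!: the_equality dest: decomp_unique)
qed

lemma decomp:
  assumes "\<sigma> \<in> arr \<Sigma>"
  shows "dom_part \<sigma> \<in> F" "trans_part \<sigma> \<in> carrier S" "\<alpha> (trans_part \<sigma>) (dom_part \<sigma>) = \<sigma>"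
proof -
  have "\<exists>!(\<mu>, t). \<mu> \<in> F \<and> t \<in> carrier S \<and> \<alpha> t \<mu> = \<sigma>"
    using fundom assms by (simp add: fundamental_domain_def)
  then obtain \<mu> t where "\<mu> \<in> F" "t \<in> carrier S" "\<sigma> = \<alpha> t \<mu>"
    unfolding case_prod_unfold by (elim ex1E) metis
  then show "dom_part \<sigma> \<in> F" "trans_part \<sigma> \<in> carrier S" "\<alpha> (trans_part \<sigma>) (dom_part \<sigma>) = \<sigma>"
    by (simp_all add: decomp_act)
qed

lemma decomp_F:
  assumes "\<mu> \<in> F"
  shows "dom_part \<mu> = \<mu>" "trans_part \<mu> = \<one>\<^bsub>S\<^esub>"
  using decomp_act[OF assms S.one_closed] act_one[OF F_arr[OF assms]] by simp_all

lemma dom_part_arr: "\<sigma> \<in> arr \<Sigma> \<Longrightarrow> dom_part \<sigma> \<in> arr \<Sigma>"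
  by (simp add: F_arr decomp)

lemma decomp_translate:
  assumes "\<sigma> \<in> arr \<Sigma>" "t \<in> carrier S"
  shows "dom_part (\<alpha> t \<sigma>) = dom_part \<sigma>" "trans_part (\<alpha> t \<sigma>) = t \<otimes>\<^bsub>S\<^esub> trans_part \<sigma>"
proof -
  have "\<alpha> t \<sigma> = \<alpha> (t \<otimes>\<^bsub>S\<^esub> trans_part \<sigma>) (dom_part \<sigma>)"
    using assms decomp[OF assms(1)] by (simp add: act_mult F_arr)
  then show "dom_part (\<alpha> t \<sigma>) = dom_part \<sigma>" "trans_part (\<alpha> t \<sigma>) = t \<otimes>\<^bsub>S\<^esub> trans_part \<sigma>"
    using assms decomp[OF assms(1)] by (simp_all add: decomp_act)
qed

text \<open>Applying \<open>rng\<close> to \<open>\<sigma> = \<alpha> t \<mu>\<close> gives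
  \<open>\<alpha> t (rng \<Sigma> \<mu>)\<close>, again a decomposition because \<open>F\<close> is
  closed under ranges.\<close>

lemma decomp_rng:
  assumes "\<sigma> \<in> arr \<Sigma>"
  shows "dom_part (rng \<Sigma> \<sigma>) = rng \<Sigma> (dom_part \<sigma>)" "trans_part (rng \<Sigma> \<sigma>) = trans_part \<sigma>"
proof -
  have "rng \<Sigma> \<sigma> = \<alpha> (trans_part \<sigma>) (rng \<Sigma> (dom_part \<sigma>))"
    using decomp[OF assms] act_rng[OF _ F_arr] by metis
  then show "dom_part (rng \<Sigma> \<sigma>) = rng \<Sigma> (dom_part \<sigma>)" "trans_part (rng \<Sigma> \<sigma>) = trans_part \<sigma>"
    using decomp[OF assms] by (simp_all add: decomp_act F_rng)
qed

text \<open>The source of an element of \<open>F\<close> may lie outside \<open>F\<close>, so it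
  brings a translating element of its own, multiplied on the right of that of
  \<open>\<sigma>\<close>. This extra factor becomes \<open>\<eta>(q(\<sigma>))\<close>.\<close>

lemma decomp_src:
  assumes "\<sigma> \<in> arr \<Sigma>"
  shows "dom_part (src \<Sigma> \<sigma>) = dom_part (src \<Sigma> (dom_part \<sigma>))"
    "trans_part (src \<Sigma> \<sigma>) = trans_part \<sigma> \<otimes>\<^bsub>S\<^esub> trans_part (src \<Sigma> (dom_part \<sigma>))"
proof -
  have "src \<Sigma> \<sigma> = \<alpha> (trans_part \<sigma>) (src \<Sigma> (dom_part \<sigma>))"
    using decomp[OF assms] act_src[OF _ F_arr] by metis
  then show "dom_part (src \<Sigma> \<sigma>) = dom_part (src \<Sigma> (dom_part \<sigma>))"
    "trans_part (src \<Sigma> \<sigma>) = trans_part \<sigma> \<otimes>\<^bsub>S\<^esub> trans_part (src \<Sigma> (dom_part \<sigma>))"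
    using decomp[OF assms] by (simp_all add: decomp_translate F_arr src_arr)
qed

text \<open>The formula for the \<open>F\<close>-part refers to \<open>l\<close> and
  \<open>m\<close> only through their own \<open>F\<close>-parts, which is what makes composition of
  orbits well defined.\<close>

lemma decomp_comp:
  assumes "l \<in> arr \<Sigma>" "m \<in> arr \<Sigma>" "src \<Sigma> l = rng \<Sigma> m"
  shows "trans_part (l \<star>\<^bsub>\<Sigma>\<^esub> m) = trans_part l"
    "dom_part (l \<star>\<^bsub>\<Sigma>\<^esub> m) =
      dom_part l \<star>\<^bsub>\<Sigma>\<^esub> \<alpha> (trans_part (src \<Sigma> (dom_part l))) (dom_part m)"
proof -
  let ?\<mu> = "dom_part l" and ?\<nu> = "dom_part m"
  let ?h = "trans_part (src \<Sigma> (dom_part l))"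
  have h: "?h \<in> carrier S" and \<mu>: "?\<mu> \<in> arr \<Sigma>" "?\<mu> \<in> F" "trans_part l \<in> carrier S"
    and \<nu>: "?\<nu> \<in> arr \<Sigma>" "?\<nu> \<in> F"
    using assms by (simp_all add: decomp dom_part_arr src_arr)
  \<comment> \<open>The translating element of the common object
    \<open>src \<Sigma> l = rng \<Sigma> m\<close> is computed once from each side.\<close>
  have tm: "trans_part m = trans_part l \<otimes>\<^bsub>S\<^esub> ?h"
    using decomp_rng(2)[OF assms(2)] decomp_src(2)[OF assms(1)] assms(3) by simp
  \<comment> \<open>Comparing the \<open>F\<close>-parts of that object shows that \<open>?h\<close>
    moves \<open>?\<nu>\<close> to an arrow composable with \<open>?\<mu>\<close>.\<close>
  have "dom_part (src \<Sigma> ?\<mu>) = rng \<Sigma> ?\<nu>"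
    using decomp_rng(1)[OF assms(2)] decomp_src(1)[OF assms(1)] assms(3) by simp
  then have s: "src \<Sigma> ?\<mu> = rng \<Sigma> (\<alpha> ?h ?\<nu>)"
    using decomp(3)[OF src_arr[OF \<mu>(1)]] h \<nu> by (simp add: act_rng)
  show t: "trans_part (l \<star>\<^bsub>\<Sigma>\<^esub> m) = trans_part l"
    using decomp_rng(2)[of l] decomp_rng(2)[of "l \<star>\<^bsub>\<Sigma>\<^esub> m"] assms
    by (simp add: comp_arr rng_comp)
  have arr: "?\<mu> \<star>\<^bsub>\<Sigma>\<^esub> \<alpha> ?h ?\<nu> \<in> arr \<Sigma>"
    using \<mu> \<nu> h s by (simp add: comp_arr rng_comp src_comp act_arr)
  have "\<alpha> (trans_part l) (?\<mu> \<star>\<^bsub>\<Sigma>\<^esub> \<alpha> ?h ?\<nu>) = \<alpha> (trans_part l) ?\<mu> \<star>\<^bsub>\<Sigma>\<^esub> \<alpha> (trans_part m) ?\<nu>"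
    using \<mu> \<nu> h s by (simp add: act_comp act_arr tm act_mult)
  then have lm: "l \<star>\<^bsub>\<Sigma>\<^esub> m = \<alpha> (trans_part l) (?\<mu> \<star>\<^bsub>\<Sigma>\<^esub> \<alpha> ?h ?\<nu>)"
    using assms by (simp add: decomp)
  \<comment> \<open>The range of the composite is that of \<open>?\<mu>\<close>, hence in
    \<open>F\<close>. An arrow has the translating element of its range, so here it is the identity
    and the composite is its own \<open>dom_part\<close>.\<close>
  have "rng \<Sigma> (?\<mu> \<star>\<^bsub>\<Sigma>\<^esub> \<alpha> ?h ?\<nu>) \<in> F"
    using \<mu> \<nu> h s by (simp add: comp_arr rng_comp src_comp act_arr F_rng)
  then have "trans_part (?\<mu> \<star>\<^bsub>\<Sigma>\<^esub> \<alpha> ?h ?\<nu>) = \<one>\<^bsub>S\<^esub>"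
    using decomp_rng(2)[OF arr] decomp_F(2) by simp
  then have "dom_part (?\<mu> \<star>\<^bsub>\<Sigma>\<^esub> \<alpha> ?h ?\<nu>) = ?\<mu> \<star>\<^bsub>\<Sigma>\<^esub> \<alpha> ?h ?\<nu>"
    using decomp[OF arr] act_one dom_part_arr[OF arr] by simp
  then show "dom_part (l \<star>\<^bsub>\<Sigma>\<^esub> m) = ?\<mu> \<star>\<^bsub>\<Sigma>\<^esub> \<alpha> ?h ?\<nu>"
    using decomp_translate(1)[OF arr \<mu>(3)] lm by simp
qed

section \<open>Orbits and the operations of the quotient\<close>

lemma orbit_rel_iff:
  "(l, m) \<in> orbit_rel S \<Sigma> \<alpha> \<longleftrightarrow> l \<in> arr \<Sigma> \<and> m \<in> arr \<Sigma> \<and> dom_part l = dom_part m"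
proof
  assume "(l, m) \<in> orbit_rel S \<Sigma> \<alpha>"
  then show "l \<in> arr \<Sigma> \<and> m \<in> arr \<Sigma> \<and> dom_part l = dom_part m"
    unfolding orbit_rel_def by clarsimp (metis decomp_translate(1))
next
  assume lm: "l \<in> arr \<Sigma> \<and> m \<in> arr \<Sigma> \<and> dom_part l = dom_part m"
  \<comment> \<open>The Ore condition joins two translates of one element of \<open>F\<close>: after
    acting by \<open>x\<close> and \<open>y\<close> their translating elements agree.\<close>
  then obtain x y where xy: "x \<in> carrier S" "y \<in> carrier S"
    "x \<otimes>\<^bsub>S\<^esub> trans_part l = y \<otimes>\<^bsub>S\<^esub> trans_part m"
    using S.ore[of "trans_part l" "trans_part m"] decomp(2) by blast
  have fac: "\<alpha> z k = \<alpha> (z \<otimes>\<^bsub>S\<^esub> trans_part k) (dom_part k)" if "z \<in> carrier S" "k \<in> arr \<Sigma>" for z k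
    using that by (simp add: act_mult decomp dom_part_arr)
  have "\<alpha> x l = \<alpha> y m"
    using lm xy fac[of x l] fac[of y m] by simp
  then show "(l, m) \<in> orbit_rel S \<Sigma> \<alpha>"
    using lm xy by (auto simp: orbit_rel_def)
qed

lemma mem_orbit: "m \<in> q l \<longleftrightarrow> l \<in> arr \<Sigma> \<and> m \<in> arr \<Sigma> \<and> dom_part l = dom_part m"
  by (simp add: orbit_map_def orbit_rel_iff)

lemma orbit_eq_iff: "\<lbrakk>l \<in> arr \<Sigma>; m \<in> arr \<Sigma>\<rbrakk> \<Longrightarrow> q l = q m \<longleftrightarrow> dom_part l = dom_part m"
  by (auto simp: set_eq_iff mem_orbit)

lemma orbit_dom_part: "l \<in> arr \<Sigma> \<Longrightarrow> q (dom_part l) = q l"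
  by (simp add: orbit_eq_iff dom_part_arr decomp_F decomp)

lemma orbit_translate: "\<lbrakk>l \<in> arr \<Sigma>; t \<in> carrier S\<rbrakk> \<Longrightarrow> q (\<alpha> t l) = q l"
  by (simp add: orbit_eq_iff act_arr decomp_translate)

lemma arr_Q: "arr Q = q ` arr \<Sigma>"
  by (auto simp: quotient_kgraph_def quotient_def orbit_map_def)

lemma rng_Q: "l \<in> arr \<Sigma> \<Longrightarrow> rng Q (q l) = q (rng \<Sigma> l)"
  unfolding quotient_kgraph_def
  by (auto simp: mem_orbit orbit_eq_iff rng_arr decomp_rng intro!: the_equality)

text \<open>By \<open>decomp_src\<close>, the \<open>F\<close>-part of a source depends only on the
  \<open>F\<close>-part of the arrow, so all representatives yield one class and the definite
  description denotes it.\<close>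

lemma src_Q:
  assumes "l \<in> arr \<Sigma>"
  shows "src Q (q l) = q (src \<Sigma> l)"
proof -
  have "q (src \<Sigma> m) = q (src \<Sigma> l)" if "m \<in> arr \<Sigma>" "dom_part l = dom_part m" for m
    using that assms by (simp add: orbit_eq_iff src_arr decomp_src(1)[of m] decomp_src(1)[of l])
  moreover have "l \<in> q l" using assms by (simp add: mem_orbit)
  ultimately have "(THE C. \<exists>m \<in> q l. C = q (src \<Sigma> m)) = q (src \<Sigma> l)"
    by (intro the_equality) (blast, metis mem_orbit)
  then show ?thesis by (simp add: quotient_kgraph_def)
qed

lemma deg_Q:
  assumes "l \<in> arr \<Sigma>"
  shows "deg Q (q l) = deg \<Sigma> l"
proof -
  \<comment> \<open>The action preserves degrees, so every member of an orbit has the degree of the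
    common \<open>F\<close>-part.\<close>
  have "deg \<Sigma> (dom_part m) = deg \<Sigma> m" if "m \<in> arr \<Sigma>" for m
    using act_deg[of "trans_part m" "dom_part m"] that by (simp add: decomp dom_part_arr)
  then have "deg \<Sigma> m = deg \<Sigma> l" if "m \<in> arr \<Sigma>" "dom_part l = dom_part m" for m
    using that assms by metis
  moreover have "l \<in> q l" using assms by (simp add: mem_orbit)
  ultimately have "(THE n. \<exists>m \<in> q l. n = deg \<Sigma> m) = deg \<Sigma> l"
    by (intro the_equality) (blast, metis mem_orbit)
  then show ?thesis by (simp add: quotient_kgraph_def)
qed

text \<open>Representatives composable as they stand are translated by the identity. Any other
  admissible translates give the same class, since \<open>decomp_comp\<close> involves only
  \<open>F\<close>-parts and these are invariant under the action.\<close>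

lemma comp_Q:
  assumes "l \<in> arr \<Sigma>" "m \<in> arr \<Sigma>" "src \<Sigma> l = rng \<Sigma> m"
  shows "q l \<star>\<^bsub>Q\<^esub> q m = q (l \<star>\<^bsub>\<Sigma>\<^esub> m)"
proof -
  have "(THE C. \<exists>l' \<in> q l. \<exists>m' \<in> q m. \<exists>t \<in> carrier S. \<exists>u \<in> carrier S.
      \<alpha> t (src \<Sigma> l') = \<alpha> u (rng \<Sigma> m') \<and> C = q (\<alpha> t l' \<star>\<^bsub>\<Sigma>\<^esub> \<alpha> u m')) = q (l \<star>\<^bsub>\<Sigma>\<^esub> m)"
  proof (rule the_equality)
    show "\<exists>l' \<in> q l. \<exists>m' \<in> q m. \<exists>t \<in> carrier S. \<exists>u \<in> carrier S.
      \<alpha> t (src \<Sigma> l') = \<alpha> u (rng \<Sigma> m') \<and> q (l \<star>\<^bsub>\<Sigma>\<^esub> m) = q (\<alpha> t l' \<star>\<^bsub>\<Sigma>\<^esub> \<alpha> u m')"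
      using assms by (intro bexI[of _ l] bexI[of _ m] bexI[of _ "\<one>\<^bsub>S\<^esub>"])
        (simp_all add: mem_orbit act_one rng_arr)
  next
    fix C assume "\<exists>l' \<in> q l. \<exists>m' \<in> q m. \<exists>t \<in> carrier S. \<exists>u \<in> carrier S.
      \<alpha> t (src \<Sigma> l') = \<alpha> u (rng \<Sigma> m') \<and> C = q (\<alpha> t l' \<star>\<^bsub>\<Sigma>\<^esub> \<alpha> u m')"
    then obtain l' m' t u where *: "l' \<in> arr \<Sigma>" "m' \<in> arr \<Sigma>" "dom_part l = dom_part l'"
        "dom_part m = dom_part m'" "t \<in> carrier S" "u \<in> carrier S"
        "\<alpha> t (src \<Sigma> l') = \<alpha> u (rng \<Sigma> m')" "C = q (\<alpha> t l' \<star>\<^bsub>\<Sigma>\<^esub> \<alpha> u m')"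
      by (auto simp: mem_orbit)
    then have c: "src \<Sigma> (\<alpha> t l') = rng \<Sigma> (\<alpha> u m')" by (simp add: act_src act_rng)
    have "dom_part (\<alpha> t l' \<star>\<^bsub>\<Sigma>\<^esub> \<alpha> u m') = dom_part (l \<star>\<^bsub>\<Sigma>\<^esub> m)"
      using * assms c by (simp add: decomp_comp act_arr decomp_translate)
    then show "C = q (l \<star>\<^bsub>\<Sigma>\<^esub> m)"
      using * assms c by (simp add: orbit_eq_iff comp_arr rng_comp src_comp act_arr)
  qed
  then show ?thesis by (simp add: quotient_kgraph_def)
qed

section \<open>Lifting composable orbits, and the category axioms of the quotient\<close>

lemma lift_rng:
  assumes "l \<in> arr \<Sigma>" "B \<in> arr Q" "src Q (q l) = rng Q B"
  obtains m where "m \<in> arr \<Sigma>" "B = q m" "src \<Sigma> l = rng \<Sigma> m"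
proof -
  from assms(2) obtain n where n: "n \<in> arr \<Sigma>" "B = q n" by (auto simp: arr_Q)
  \<comment> \<open>The \<open>F\<close>-element of \<open>B\<close> is translated by the
    translating element of \<open>src \<Sigma> l\<close>, so that \<open>rng \<Sigma> m\<close> and
    \<open>src \<Sigma> l\<close> agree in both parts. As \<open>l\<close> stays fixed, lifting can
    be iterated.\<close>
  define m where "m = \<alpha> (trans_part (src \<Sigma> l)) (dom_part n)"
  have "dom_part (src \<Sigma> l) = rng \<Sigma> (dom_part n)"
    using assms n by (simp add: src_Q rng_Q orbit_eq_iff src_arr rng_arr decomp_rng)
  then have "rng \<Sigma> m = src \<Sigma> l"
    using decomp[OF src_arr[OF assms(1)]] n by (simp add: m_def act_rng dom_part_arr)
  moreover have "m \<in> arr \<Sigma>" "q m = B"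
    using n assms(1) by (simp_all add: m_def act_arr dom_part_arr decomp src_arr
        orbit_translate orbit_dom_part)
  ultimately show ?thesis using that by auto
qed

lemma lift_pair:
  assumes "A \<in> arr Q" "B \<in> arr Q" "src Q A = rng Q B"
  obtains l m where "l \<in> arr \<Sigma>" "m \<in> arr \<Sigma>" "A = q l" "B = q m" "src \<Sigma> l = rng \<Sigma> m"
proof -
  from assms(1) obtain l where "l \<in> arr \<Sigma>" "A = q l" by (auto simp: arr_Q)
  with lift_rng[of l B] assms that show ?thesis by metis
qed

lemma category_Q: "category Q"
proof
  fix A assume "A \<in> arr Q"
  then obtain l where l: "l \<in> arr \<Sigma>" "A = q l" by (auto simp: arr_Q)
  show "rng Q A \<in> arr Q" "src Q A \<in> arr Q"
    using l by (auto simp: arr_Q rng_Q src_Q rng_arr src_arr)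
  show "rng Q (rng Q A) = rng Q A" "src Q (rng Q A) = rng Q A"
    "rng Q (src Q A) = src Q A" "src Q (src Q A) = src Q A"
    using l by (simp_all add: rng_Q src_Q rng_arr src_arr rng_rng src_rng rng_src src_src)
  show "rng Q A \<star>\<^bsub>Q\<^esub> A = A" "A \<star>\<^bsub>Q\<^esub> src Q A = A"
    using l by (simp_all add: rng_Q src_Q comp_Q rng_arr src_arr src_rng rng_src comp_rng comp_src)
next
  fix A B assume "A \<in> arr Q" "B \<in> arr Q" "src Q A = rng Q B"
  then obtain l m where lm: "l \<in> arr \<Sigma>" "m \<in> arr \<Sigma>" "A = q l" "B = q m" "src \<Sigma> l = rng \<Sigma> m"
    by (rule lift_pair)
  show "A \<star>\<^bsub>Q\<^esub> B \<in> arr Q" "rng Q (A \<star>\<^bsub>Q\<^esub> B) = rng Q A" "src Q (A \<star>\<^bsub>Q\<^esub> B) = src Q B"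
    using lm by (auto simp: comp_Q arr_Q rng_Q src_Q comp_arr rng_comp src_comp)
next
  fix A B C
  assume *: "A \<in> arr Q" "B \<in> arr Q" "C \<in> arr Q" "src Q A = rng Q B" "src Q B = rng Q C"
  then obtain l m where lm: "l \<in> arr \<Sigma>" "m \<in> arr \<Sigma>" "A = q l" "B = q m" "src \<Sigma> l = rng \<Sigma> m"
    using lift_pair by metis
  \<comment> \<open>The third class is lifted relative to the \<open>m\<close> already chosen, so
    the whole triple composes in \<open>\<Sigma>\<close>.\<close>
  obtain n where n: "n \<in> arr \<Sigma>" "C = q n" "src \<Sigma> m = rng \<Sigma> n"
    using lift_rng[of m C] lm * by metis
  show "A \<star>\<^bsub>Q\<^esub> B \<star>\<^bsub>Q\<^esub> C = A \<star>\<^bsub>Q\<^esub> (B \<star>\<^bsub>Q\<^esub> C)"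
    using lm n by (simp add: comp_Q comp_arr rng_comp src_comp comp_assoc)
qed

section \<open>The maps \<open>c\<close>, \<open>\<eta>\<close>, \<open>\<xi>\<close> and their
  uniqueness\<close>

definition section_map :: "'a set \<Rightarrow> 'a" where
  "section_map = (\<lambda>A \<in> arr Q. dom_part (SOME l. l \<in> A))"

text \<open>In the equation for \<open>s(c(\<lambda>))\<close> the element
  \<open>c(s(\<lambda>))\<close> lies in \<open>F\<close>. The equation is therefore the
  decomposition of \<open>s(c(\<lambda>))\<close>, and \<open>\<eta>(\<lambda>)\<close> must be its
  translating element.\<close>

definition cocycle :: "'a set \<Rightarrow> 's" where
  "cocycle = (\<lambda>A \<in> arr Q. trans_part (src \<Sigma> (section_map A)))"

definition translation :: "'a \<Rightarrow> 's" where
  "translation = restrict trans_part (arr \<Sigma>)"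

text \<open>The choice made by \<open>SOME\<close> is immaterial, since \<open>dom_part\<close> is
  constant on an orbit.\<close>

lemma section_map_orbit:
  assumes "l \<in> arr \<Sigma>"
  shows "section_map (q l) = dom_part l"
proof -
  have "l \<in> q l" using assms by (simp add: mem_orbit)
  then have "(SOME m. m \<in> q l) \<in> q l" by (rule someI)
  then have "dom_part (SOME m. m \<in> q l) = dom_part l"
    by (metis mem_orbit)
  then show ?thesis using assms by (simp add: section_map_def arr_Q)
qed

lemma cocycle_orbit:
  "l \<in> arr \<Sigma> \<Longrightarrow> cocycle (q l) = trans_part (src \<Sigma> (dom_part l))"
  by (simp add: cocycle_def section_map_orbit arr_Q)

text \<open>Each defining equation decomposes an arrow over \<open>F\<close>, so uniqueness of
  decompositions fixes the maps on their domains and extensionality fixes them elsewhere. This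
  settles existence and uniqueness, and reduces the other claims to explicit maps.\<close>

lemma domain_maps_iff:
  "domain_maps S \<Sigma> \<alpha> F c \<eta> \<xi> \<longleftrightarrow> c = section_map \<and> \<eta> = cocycle \<and> \<xi> = translation"
proof (intro iffI conjI)
  assume dm: "domain_maps S \<Sigma> \<alpha> F c \<eta> \<xi>"
  have ext: "c \<in> extensional (arr Q)" "\<eta> \<in> extensional (arr Q)" "\<xi> \<in> extensional (arr \<Sigma>)"
    using dm unfolding domain_maps_def Let_def PiE_iff by blast+
  have c: "c A \<in> F" "q (c A) = A" "\<eta> A \<in> carrier S" "src \<Sigma> (c A) = \<alpha> (\<eta> A) (c (src Q A))"
    if "A \<in> arr Q" for A
    using dm that unfolding domain_maps_def Let_def PiE_iff by metis+
  have x: "\<xi> \<sigma> \<in> carrier S" "\<alpha> (\<xi> \<sigma>) (c (q \<sigma>)) = \<sigma>" if "\<sigma> \<in> arr \<Sigma>" for \<sigma>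
    using dm that unfolding domain_maps_def Let_def PiE_iff by metis+
  \<comment> \<open>As an element of \<open>F\<close>, \<open>c A\<close> is its own
    \<open>dom_part\<close>, and its orbit is \<open>A\<close>.\<close>
  have cq: "c A = section_map A" if "A \<in> arr Q" for A
    using section_map_orbit[of "c A"] c[OF that] by (simp add: decomp_F F_arr)
  show "c = section_map"
    by (rule extensionalityI[OF ext(1)]) (simp add: section_map_def, erule cq)
  show "\<eta> = cocycle"
  proof (rule extensionalityI[OF ext(2)])
    fix A assume A: "A \<in> arr Q"
    have "src Q A \<in> arr Q" using category.src_arr[OF category_Q A] .
    then have "trans_part (src \<Sigma> (c A)) = \<eta> A"
      using c[OF A] c(1)[of "src Q A"] by (simp add: decomp_act)
    then show "\<eta> A = cocycle A" using A by (simp add: cocycle_def cq)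
  qed (simp add: cocycle_def)
  show "\<xi> = translation"
  proof (rule extensionalityI[OF ext(3)])
    fix \<sigma> assume s: "\<sigma> \<in> arr \<Sigma>"
    then show "\<xi> \<sigma> = translation \<sigma>"
      using decomp_act(2)[of "c (q \<sigma>)" "\<xi> \<sigma>"] x[OF s] c(1)[of "q \<sigma>"]
      by (simp add: arr_Q translation_def)
  qed (simp add: translation_def)
next
  assume "c = section_map \<and> \<eta> = cocycle \<and> \<xi> = translation"
  moreover have "section_map \<in> arr Q \<rightarrow>\<^sub>E F"
    by (auto simp: arr_Q section_map_orbit decomp PiE_iff) (simp add: section_map_def arr_Q)
  moreover have "cocycle \<in> arr Q \<rightarrow>\<^sub>E carrier S"
    by (auto simp: arr_Q cocycle_orbit decomp src_arr dom_part_arr PiE_iff)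
      (simp add: cocycle_def arr_Q)
  moreover have "translation \<in> arr \<Sigma> \<rightarrow>\<^sub>E carrier S"
    by (auto simp: translation_def decomp)
  moreover have "src \<Sigma> (section_map A) = \<alpha> (cocycle A) (section_map (src Q A))"
    if "A \<in> arr Q" for A
  proof -
    from that obtain l where l: "l \<in> arr \<Sigma>" "A = q l" by (auto simp: arr_Q)
    then show ?thesis
      using decomp(3)[OF src_arr[OF dom_part_arr[OF l(1)]]]
      by (simp add: src_Q section_map_orbit cocycle_orbit src_arr decomp_src(1)[of l])
  qed
  ultimately show "domain_maps S \<Sigma> \<alpha> F c \<eta> \<xi>"
    by (auto simp: domain_maps_def arr_Q section_map_orbit orbit_dom_part translation_def decomp)
qed

section \<open>The cocycle identity\<close>

lemma trans_part_src:
  "l \<in> arr \<Sigma> \<Longrightarrow> trans_part (src \<Sigma> l) = trans_part l \<otimes>\<^bsub>S\<^esub> cocycle (q l)"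
  by (simp add: cocycle_orbit decomp_src(2))

lemma cocycle_carrier: "l \<in> arr \<Sigma> \<Longrightarrow> cocycle (q l) \<in> carrier S"
  by (simp add: cocycle_orbit decomp src_arr dom_part_arr)

text \<open>When the source is \<open>v\<close> itself, \<open>trans_part v\<close> stands on both
  sides of \<open>trans_part_src\<close> and cancels.\<close>

lemma cocycle_obj:
  assumes "v \<in> arr \<Sigma>" "src \<Sigma> v = v"
  shows "cocycle (q v) = \<one>\<^bsub>S\<^esub>"
proof -
  have "trans_part v \<otimes>\<^bsub>S\<^esub> cocycle (q v) = trans_part v \<otimes>\<^bsub>S\<^esub> \<one>\<^bsub>S\<^esub>"
    using trans_part_src[OF assms(1)] assms by (simp add: decomp)
  then show ?thesis
    using S.l_cancel assms by (blast intro: cocycle_carrier decomp)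
qed

text \<open>After left multiplication by \<open>trans_part l\<close>, both sides give the
  translating element of \<open>src \<Sigma> m\<close>: one through the composite, which has the
  translating element of \<open>l\<close>, the other in two stages through
  \<open>src \<Sigma> l = rng \<Sigma> m\<close>.\<close>

lemma cocycle_comp:
  assumes "l \<in> arr \<Sigma>" "m \<in> arr \<Sigma>" "src \<Sigma> l = rng \<Sigma> m"
  shows "cocycle (q (l \<star>\<^bsub>\<Sigma>\<^esub> m)) = cocycle (q l) \<otimes>\<^bsub>S\<^esub> cocycle (q m)"
proof -
  have "trans_part l \<otimes>\<^bsub>S\<^esub> cocycle (q (l \<star>\<^bsub>\<Sigma>\<^esub> m)) = trans_part (src \<Sigma> m)"
    using trans_part_src[of "l \<star>\<^bsub>\<Sigma>\<^esub> m"] assms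
    by (simp add: comp_arr src_comp decomp_comp)
  also have "\<dots> = trans_part (src \<Sigma> l) \<otimes>\<^bsub>S\<^esub> cocycle (q m)"
    using assms by (simp add: trans_part_src[of m] decomp_rng)
  also have "\<dots> = trans_part l \<otimes>\<^bsub>S\<^esub> (cocycle (q l) \<otimes>\<^bsub>S\<^esub> cocycle (q m))"
    using assms(1,2) by (simp add: trans_part_src S.m_assoc decomp cocycle_carrier)
  finally show ?thesis
    using S.l_cancel assms
    by (blast intro: cocycle_carrier decomp S.m_closed comp_arr)
qed

lemma cocycle_functor: "cat_functor Q (monoid_cat S) cocycle"
proof -
  interpret Q: category Q by (rule category_Q)
  interpret M: category "monoid_cat S" by (rule monoid_cat_category) unfold_locales
  show ?thesis
  proof
    fix A assume "A \<in> arr Q"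
    \<comment> \<open>All ranges and sources in \<open>monoid_cat S\<close> are the identity, so
      preserving them means that \<open>cocycle\<close> is trivial on objects.\<close>
    then show "cocycle A \<in> arr (monoid_cat S)"
      and "cocycle (rng Q A) = rng (monoid_cat S) (cocycle A)"
      and "cocycle (src Q A) = src (monoid_cat S) (cocycle A)"
      by (auto simp: arr_Q monoid_cat_def cocycle_carrier rng_Q src_Q cocycle_obj rng_arr src_arr
          src_rng src_src)
  next
    fix A B assume "A \<in> arr Q" "B \<in> arr Q" "src Q A = rng Q B"
    then obtain l m where "l \<in> arr \<Sigma>" "m \<in> arr \<Sigma>" "A = q l" "B = q m" "src \<Sigma> l = rng \<Sigma> m"
      by (rule lift_pair)
    then show "cocycle (A \<star>\<^bsub>Q\<^esub> B) = cocycle A \<star>\<^bsub>monoid_cat S\<^esub> cocycle B"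
      by (simp add: comp_Q cocycle_comp monoid_cat_def)
  qed
qed

section \<open>The isomorphism onto the skew product\<close>

definition skew_map :: "'a \<Rightarrow> 'a set \<times> 's" where
  "skew_map \<sigma> = (q \<sigma>, translation \<sigma>)"

text \<open>With \<open>section_skew_map\<close> this makes
  \<open>(A, t) \<mapsto> \<alpha> t (section_map A)\<close> a two-sided inverse, whence bijectivity
  and the formula for the inverse.\<close>

lemma skew_map_section:
  assumes "A \<in> arr Q" "t \<in> carrier S"
  shows "\<alpha> t (section_map A) \<in> arr \<Sigma>" "skew_map (\<alpha> t (section_map A)) = (A, t)"
  using assms by (auto simp: arr_Q section_map_orbit skew_map_def translation_def act_arr
      dom_part_arr orbit_translate orbit_dom_part decomp_act decomp)

lemma skew_map_arr: "\<sigma> \<in> arr \<Sigma> \<Longrightarrow> skew_map \<sigma> \<in> arr Q \<times> carrier S"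
  by (simp add: skew_map_def arr_Q translation_def decomp)

lemma section_skew_map:
  "\<sigma> \<in> arr \<Sigma> \<Longrightarrow> \<alpha> (translation \<sigma>) (section_map (q \<sigma>)) = \<sigma>"
  by (simp add: translation_def section_map_orbit decomp)

lemma skew_map_inj: "inj_on skew_map (arr \<Sigma>)"
  by (rule inj_onI) (metis section_skew_map skew_map_def prod.inject)

lemma skew_map_bij: "bij_betw skew_map (arr \<Sigma>) (arr Q \<times> carrier S)"
  unfolding bij_betw_def
proof (intro conjI skew_map_inj equalityI subsetI)
  fix p assume "p \<in> arr Q \<times> carrier S"
  then show "p \<in> skew_map ` arr \<Sigma>"
    using skew_map_section by (metis imageI mem_Times_iff prod.collapse)
next
  fix p assume "p \<in> skew_map ` arr \<Sigma>"
  then show "p \<in> arr Q \<times> carrier S" using skew_map_arr by blast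
qed

text \<open>In the second coordinate, compatibility with ranges is \<open>decomp_rng\<close>, with
  sources \<open>trans_part_src\<close>, and with composition the fact that a composite has the
  translating element of its first factor.\<close>

lemma skew_map_iso: "kgraph_iso \<Sigma> (skew_product Q cocycle S) skew_map"
proof (rule transport_iso)
  show "bij_betw skew_map (arr \<Sigma>) (arr (skew_product Q cocycle S))"
    using skew_map_bij by (simp add: skew_product_def)
qed (simp_all add: skew_product_def skew_map_def translation_def rng_Q src_Q comp_Q deg_Q
    rng_arr src_arr comp_arr rng_comp src_comp decomp_rng decomp_comp trans_part_src)

lemma skew_map_inverse:
  "\<lbrakk>A \<in> arr Q; t \<in> carrier S\<rbrakk> \<Longrightarrow> inv_into (arr \<Sigma>) skew_map (A, t) = \<alpha> t (section_map A)"
  by (rule inv_into_f_eq[OF skew_map_inj skew_map_section])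

lemma skew_map_translate:
  "\<lbrakk>t \<in> carrier S; \<sigma> \<in> arr \<Sigma>\<rbrakk> \<Longrightarrow> skew_map (\<alpha> t \<sigma>) = left_translation S t (skew_map \<sigma>)"
  by (simp add: skew_map_def left_translation_def translation_def orbit_translate act_arr
      decomp_translate)

end

theorem theorem3p2:
  fixes S :: "('s, 'm) monoid_scheme"
    and \<Sigma> :: "('a, 'k::finite, 'x) kgraph_scheme"
    and \<alpha> :: "'s \<Rightarrow> 'a \<Rightarrow> 'a"
    and F :: "'a set"
  assumes "k_graph \<Sigma>"
    and "row_finite_no_sources \<Sigma>"
    and "ore_semigroup S"
    and "free_kgraph_action S \<Sigma> \<alpha>"
    and "fundamental_domain S \<Sigma> \<alpha> F"
  shows "(\<exists>!(c, \<eta>, \<xi>). domain_maps S \<Sigma> \<alpha> F c \<eta> \<xi>) \<and>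
    (\<forall>c \<eta> \<xi>. domain_maps S \<Sigma> \<alpha> F c \<eta> \<xi> \<longrightarrow>
      (let Q = quotient_kgraph S \<Sigma> \<alpha>;
           \<phi> = (\<lambda>\<sigma>. (orbit_map S \<Sigma> \<alpha> \<sigma>, \<xi> \<sigma>))
       in cat_functor Q (monoid_cat S) \<eta> \<and>
          kgraph_iso \<Sigma> (skew_product Q \<eta> S) \<phi> \<and>
          (\<forall>l \<in> arr Q. \<forall>t \<in> carrier S. inv_into (arr \<Sigma>) \<phi> (l, t) = \<alpha> t (c l)) \<and>
          (\<forall>t \<in> carrier S. \<forall>\<sigma> \<in> arr \<Sigma>. \<phi> (\<alpha> t \<sigma>) = left_translation S t (\<phi> \<sigma>))))"
proof -
  interpret K: k_graph \<Sigma> by (rule assms(1))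
  interpret O: ore_semigroup S by (rule assms(3))
  interpret domain_action \<Sigma> S \<alpha> F
    using assms(4,5) by unfold_locales (auto simp: free_kgraph_action_def)
  \<comment> \<open>Once \<open>domain_maps_iff\<close> has identified \<open>\<xi>\<close> with
    \<open>translation\<close>, the map \<open>\<phi>\<close> of the statement is
    \<open>skew_map\<close>.\<close>
  have map_eq: "(\<lambda>\<sigma>. (orbit_map S \<Sigma> \<alpha> \<sigma>, translation \<sigma>)) = skew_map"
    by (simp add: fun_eq_iff skew_map_def)
  have "\<exists>!(c, \<eta>, \<xi>). domain_maps S \<Sigma> \<alpha> F c \<eta> \<xi>"
    by (rule ex1I[of _ "(section_map, cocycle, translation)"]) (auto simp: domain_maps_iff)
  then show ?thesis
    using cocycle_functor skew_map_iso skew_map_inverse skew_map_translate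
    by (auto simp: domain_maps_iff Let_def map_eq)
qed

end
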